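(* Let $X$ be a Tychonoff space and let $\mathscr{P}$ be an ideal of closed sets in $X$ with $|X_\mathscr{P}|\geq 3$. Then $cl(G(C_\mathscr{P}(X)))=cl(AG(C_\mathscr{P}(X)))$, where $cl$ denotes the clique number.
   Context: $C(X)$ is the ring of all real valued continuous functions on the Tychonoff (completely regular Hausdorff) space $X$; $Z(f)=\{x\in X: f(x)=0\}$. An ideal of closed sets in $X$ is a nonempty family $\mathscr{P}$ of closed subsets of $X$ such that $A,B\in\mathscr{P}$ implies $A\cup B\in\mathscr{P}$, and $A\in\mathscr{P}$, $C\subset A$ with $C$ closed in $X$ implies $C\in\mathscr{P}$. $C_\mathscr{P}(X)=\{f\in C(X): cl_X(X\setminus Z(f))\in\mathscr{P}\}$, a commutative ring (possibly without identity). $X_\mathscr{P}$ is the set of all $x\in X$ having an open neighborhood $V$ with $cl_XV\in\mathscr{P}$. For a commutative ring $R$, $Z(R)^*$ is the set of nonzero zero divisors, i.e. nonzero $a\in R$ with $ab=0$ for some nonzero $b\in R$, and $ann(a)=\{r\in R: ra=0\}$. The annihilator graph $AG(R)$ is the simple graph with vertex set $Z(R)^*$ in which distinct $a,b$ are adjacent iff $ann(a)\cup ann(b)\neq ann(ab)$. On $C_\mathscr{P}(X)$ define the equivalence relation $f\sim g$ iff $int_XZ(f)\cap X_\mathscr{P}=int_XZ(g)\cap X_\mathscr{P}$. Fix a set $S\subset C_\mathscr{P}(X)$ containing exactly one element of each equivalence class, and put $V(C_\mathscr{P}(X))=\{f\in S\setminus\{0\}: int_XZ(f)\cap X_\mathscr{P}\neq\emptyset\}$,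 which is a subset of $Z(C_\mathscr{P}(X))^*$. $G(C_\mathscr{P}(X))$ is the induced subgraph of $AG(C_\mathscr{P}(X))$ with vertex set $V(C_\mathscr{P}(X))$. The clique number $cl(H)$ of a graph $H$ is the supremum of the cardinalities (finite or infinite) of sets of pairwise adjacent vertices of $H$. *)

theory Defs
  imports "HOL-Analysis.Analysis" "HOL-Library.Function_Algebras"
begin

unbundle cardinal_syntax
no_notation elt_set_eq (infix \<open>=o\<close> 50)

section \<open>Clique number\<close>

text \<open>
  A simple graph is a vertex set together with a set of two-element sets of vertices.
\<close>

type_synonym 'v graph = "'v set \<times> 'v set set"

definition induced_subgraph :: "'v graph \<Rightarrow> 'v set \<Rightarrow> 'v graph" where
  "induced_subgraph H W = (W, {e \<in> snd H. e \<subseteq> W})"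

definition is_clique :: "'v graph \<Rightarrow> 'v set \<Rightarrow> bool" where
  "is_clique H K \<longleftrightarrow> K \<subseteq> fst H \<and> (\<forall>x\<in>K. \<forall>y\<in>K. x \<noteq> y \<longrightarrow> {x, y} \<in> snd H)"

text \<open>
  Cardinals are the cardinal well-orders of the library, compared by \<open>\<le>o\<close> and identified up
  to \<open>=o\<close>. Every clique is a subset of the vertex type, so all cardinals that matter have
  a representative on that type.
\<close>

definition is_card_Sup :: "'v rel set \<Rightarrow> 'v rel \<Rightarrow> bool" where
  "is_card_Sup C k \<longleftrightarrow>
     Card_order k \<and> (\<forall>c\<in>C. c \<le>o k) \<and>
     (\<forall>k' :: 'v rel. Card_order k' \<and> (\<forall>c\<in>C. c \<le>o k') \<longrightarrow> k \<le>o k')"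

definition clique_number :: "'v graph \<Rightarrow> 'v rel" where
  "clique_number H = (SOME k. is_card_Sup {|K| | K. is_clique H K} k)"

text \<open>
  The supremum exists and is unique up to \<open>=o\<close>, so the choice above is well defined.
\<close>

lemma is_card_Sup_clique_number:
  fixes H :: "'v graph"
  shows "is_card_Sup {|K| | K. is_clique H K} (clique_number H)"
proof -
  let ?C = "{|K| | K. is_clique H K}"
  let ?U = "{k :: 'v rel. Card_order k \<and> (\<forall>c\<in>?C. c \<le>o k)}"
  have U: "|UNIV :: 'v set| \<in> ?U"
  proof (intro CollectI conjI card_of_Card_order ballI)
    fix c assume "c \<in> ?C"
    then obtain K where "c = |K|" by (elim CollectE exE conjE)
    then show "c \<le>o |UNIV :: 'v set|" using card_of_mono1[OF subset_UNIV] by simp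
  qed
  obtain k where k: "k \<in> ?U" and min: "\<And>k'. k' <o k \<Longrightarrow> k' \<notin> ?U"
  proof (rule wfE_min[OF wf_ordLess U])
    fix z :: "'v rel"
    assume "z \<in> ?U" and "\<And>y. y <o z \<Longrightarrow> y \<notin> ?U"
    then show thesis by (rule that)
  qed
  have kC: "Card_order k" "\<forall>c\<in>?C. c \<le>o k"
    using k unfolding mem_Collect_eq[of k] by (rule conjunct1, rule conjunct2)
  have least: "k \<le>o k'" if "Card_order k'" "\<forall>c\<in>?C. c \<le>o k'" for k' :: "'v rel"
  proof -
    have "k' \<in> ?U" by (rule CollectI, rule conjI, fact that(1), fact that(2))
    then have "\<not> k' <o k" using min by blast
    then show ?thesis
      using not_ordLess_iff_ordLeq[of k k'] kC(1) that(1)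
      by (simp only: card_order_on_well_order_on simp_thms)
  qed
  have "is_card_Sup ?C k"
    unfolding is_card_Sup_def
    by (intro conjI allI impI, fact kC(1), fact kC(2), elim conjE, rule least)
  then show ?thesis unfolding clique_number_def by (rule someI)
qed

lemma is_card_Sup_unique: "is_card_Sup C k \<Longrightarrow> is_card_Sup C k' \<Longrightarrow> k =o k'"
  by (auto simp: is_card_Sup_def ordIso_iff_ordLeq)

section \<open>The annihilator graph\<close>

text \<open>
  A commutative ring without identity is represented as a subset \<open>R\<close> of an ambient commutative
  ring that is closed under the ring operations.
\<close>

definition ann :: "'r::comm_ring set \<Rightarrow> 'r \<Rightarrow> 'r set" where
  "ann R a = {r \<in> R. r * a = 0}"

definition nz_zero_divisors :: "'r::comm_ring set \<Rightarrow> 'r set" where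
  "nz_zero_divisors R = {a \<in> R. a \<noteq> 0 \<and> (\<exists>b\<in>R. b \<noteq> 0 \<and> a * b = 0)}"

definition annihilator_graph :: "'r::comm_ring set \<Rightarrow> 'r graph" where
  "annihilator_graph R =
     (nz_zero_divisors R,
      {{a, b} | a b. a \<in> nz_zero_divisors R \<and> b \<in> nz_zero_divisors R \<and> a \<noteq> b \<and>
                     ann R a \<union> ann R b \<noteq> ann R (a * b)})"

section \<open>Rings of continuous functions given by ideals of closed sets\<close>

definition ideal_of_closed_sets :: "'a topology \<Rightarrow> 'a set set \<Rightarrow> bool" where
  "ideal_of_closed_sets X \<P> \<longleftrightarrow>
     \<P> \<noteq> {} \<and> (\<forall>A\<in>\<P>. closedin X A) \<and>
     (\<forall>A\<in>\<P>. \<forall>B\<in>\<P>. A \<union> B \<in> \<P>) \<and>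
     (\<forall>A\<in>\<P>. \<forall>C. C \<subseteq> A \<and> closedin X C \<longrightarrow> C \<in> \<P>)"

text \<open>
  A real function on the space is represented by its extension by 0 to the whole type. Thus
  equality of functions is equality on \<open>topspace X\<close>, and the ring operations, including the
  zero element, are the pointwise ones on \<open>'a \<Rightarrow> real\<close>.
\<close>

definition C_ring :: "'a topology \<Rightarrow> ('a \<Rightarrow> real) set" where
  "C_ring X = {f. continuous_map X euclideanreal f \<and> (\<forall>x. x \<notin> topspace X \<longrightarrow> f x = 0)}"

definition zero_set :: "'a topology \<Rightarrow> ('a \<Rightarrow> real) \<Rightarrow> 'a set" where
  "zero_set X f = {x \<in> topspace X. f x = 0}"

definition CP_ring :: "'a topology \<Rightarrow> 'a set set \<Rightarrow> ('a \<Rightarrow> real) set" where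
  "CP_ring X \<P> = {f \<in> C_ring X. X closure_of (topspace X - zero_set X f) \<in> \<P>}"

lemma CP_ring_zero:
  assumes "ideal_of_closed_sets X \<P>" shows "0 \<in> CP_ring X \<P>"
proof -
  have "\<P> \<noteq> {}" using assms unfolding ideal_of_closed_sets_def by (rule conjunct1)
  then obtain A where "A \<in> \<P>" by blast
  then have "{} \<in> \<P>"
    using assms closedin_empty[of X] unfolding ideal_of_closed_sets_def by blast
  moreover have "topspace X - zero_set X 0 = {}" by (auto simp: zero_set_def zero_fun_def)
  moreover have "0 \<in> C_ring X" by (simp add: C_ring_def zero_fun_def)
  ultimately show ?thesis by (simp only: CP_ring_def mem_Collect_eq closure_of_empty conj_ac simp_thms)
qed

lemma CP_ring_closed:
  assumes P: "ideal_of_closed_sets X \<P>" and f: "f \<in> CP_ring X \<P>" and g: "g \<in> CP_ring X \<P>"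
  shows "f - g \<in> CP_ring X \<P>" "f * g \<in> CP_ring X \<P>"
proof -
  let ?cl = "\<lambda>h. X closure_of (topspace X - zero_set X h)"
  have U: "?cl f \<union> ?cl g \<in> \<P>"
    using P f g unfolding ideal_of_closed_sets_def CP_ring_def by blast
  have *: "h \<in> CP_ring X \<P>"
    if "h \<in> C_ring X" "zero_set X f \<inter> zero_set X g \<subseteq> zero_set X h" for h
  proof -
    have "?cl h \<subseteq> ?cl f \<union> ?cl g"
      unfolding closure_of_Un[symmetric] by (intro closure_of_mono) (use that in auto)
    moreover have "closedin X (?cl h)" by simp
    ultimately have "?cl h \<in> \<P>" using P U unfolding ideal_of_closed_sets_def by blast
    with that show ?thesis by (simp add: CP_ring_def)
  qed
  show "f - g \<in> CP_ring X \<P>"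
    by (rule *) (use f g in \<open>auto simp: CP_ring_def C_ring_def zero_set_def fun_diff_def
                              intro!: continuous_map_diff\<close>)
  show "f * g \<in> CP_ring X \<P>"
    by (rule *) (use f g in \<open>auto simp: CP_ring_def C_ring_def zero_set_def times_fun_def
                              intro!: continuous_map_real_mult\<close>)
qed

definition X_sub :: "'a topology \<Rightarrow> 'a set set \<Rightarrow> 'a set" where
  "X_sub X \<P> = {x \<in> topspace X. \<exists>V. openin X V \<and> x \<in> V \<and> X closure_of V \<in> \<P>}"

definition int_zero_rel :: "'a topology \<Rightarrow> 'a set set \<Rightarrow> ('a \<Rightarrow> real) rel" where
  "int_zero_rel X \<P> = {(f, g). f \<in> CP_ring X \<P> \<and> g \<in> CP_ring X \<P> \<and>
     X interior_of zero_set X f \<inter> X_sub X \<P> = X interior_of zero_set X g \<inter> X_sub X \<P>}"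

lemma equiv_int_zero_rel: "equiv (CP_ring X \<P>) (int_zero_rel X \<P>)"
  by (rule equivI) (auto simp: int_zero_rel_def refl_on_def sym_def trans_def)

definition is_transversal :: "'v set \<Rightarrow> 'v rel \<Rightarrow> 'v set \<Rightarrow> bool" where
  "is_transversal A r S \<longleftrightarrow> S \<subseteq> A \<and> (\<forall>E \<in> A // r. \<exists>!s. s \<in> S \<inter> E)"

definition V_set :: "'a topology \<Rightarrow> 'a set set \<Rightarrow> ('a \<Rightarrow> real) set \<Rightarrow> ('a \<Rightarrow> real) set" where
  "V_set X \<P> S = {f \<in> S - {0}. X interior_of zero_set X f \<inter> X_sub X \<P> \<noteq> {}}"

definition G_graph :: "'a topology \<Rightarrow> 'a set set \<Rightarrow> ('a \<Rightarrow> real) set \<Rightarrow> ('a \<Rightarrow> real) graph" where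
  "G_graph X \<P> S = induced_subgraph (annihilator_graph (CP_ring X \<P>)) (V_set X \<P> S)"

end

theory Submission
  imports Defs
begin

text \<open>
  Whether two elements are adjacent in the annihilator graph of a reduced ring depends only on
  their annihilators, since \<open>h \<in> ann (a * b)\<close> says \<open>h * b \<in> ann a\<close> (lemma \<open>ann_mult_cong\<close>).
  Moreover two elements with the same annihilator are never adjacent
  (\<open>ann_mult_of_ann_eq\<close>). So a clique meets every class of elements with a common annihilator at
  most once, and moving each of its members to a chosen representative of its class gives a clique
  of the same cardinality. Hence restricting the annihilator graph to a set of representatives does
  not change the clique number (\<open>clique_number_ann_representatives\<close>).

  It remains to see that the vertex set \<open>V_set X \<P> S\<close> is such a set of representatives for
  \<open>CP_ring X \<P>\<close>. Equivalent functions have the same annihilator because the cozero set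
  of a member \<open>h\<close> of the ring is an open subset of \<open>X_sub X \<P>\<close>, so that \<open>h * f = 0\<close>
  means that this cozero set lies inside \<open>X interior_of zero_set X f \<inter> X_sub X \<P>\<close>
  (\<open>mult_eq_0_iff_cozero_subset\<close>). Complete regularity gives the other half: a point of that
  open set carries a nonzero member of the ring supported in it, so every element of
  \<open>V_set X \<P> S\<close> is a zero divisor (\<open>V_set_subset_nz_zero_divisors\<close>).
\<close>

section \<open>Comparing clique numbers\<close>

lemma clique_number_mono:
  fixes H H' :: "'v graph"
  assumes "\<And>K. is_clique H K \<Longrightarrow> \<exists>K'. is_clique H' K' \<and> |K| \<le>o |K'|"
  shows "clique_number H \<le>o clique_number H'"
proof -
  have upper: "c \<le>o clique_number H'" if "c \<in> {|K| | K. is_clique H K}" for c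
  proof -
    from that obtain K where c: "c = |K|" and K: "is_clique H K" by auto
    from assms[OF K] obtain K' where K': "is_clique H' K'" and le: "|K| \<le>o |K'|"
      by (elim exE conjE)
    have "|K'| \<in> {|K| | K. is_clique H' K}"
      by (rule CollectI, rule exI[of _ K'], rule conjI[OF refl K'])
    then have "|K'| \<le>o clique_number H'"
      using is_card_Sup_clique_number[of H'] unfolding is_card_Sup_def by (elim conjE) (rule bspec)
    then show ?thesis unfolding c by (rule ordLeq_transitive[OF le])
  qed
  have "Card_order (clique_number H')"
    using is_card_Sup_clique_number[of H'] unfolding is_card_Sup_def by (rule conjunct1)
  moreover have "Card_order k' \<and> (\<forall>c\<in>{|K| | K. is_clique H K}. c \<le>o k')
      \<longrightarrow> clique_number H \<le>o k'" for k' :: "'v rel"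
    using is_card_Sup_clique_number[of H] unfolding is_card_Sup_def by (elim conjE) (rule spec)
  ultimately show ?thesis using upper by (metis (no_types))
qed

section \<open>The annihilator graph of a reduced ring\<close>

lemma ann_mult_cong:
  assumes closed: "\<forall>x\<in>R. \<forall>y\<in>R. x * y \<in> R"
    and "b \<in> R" and "ann R a = ann R a'"
  shows "ann R (a * b) = ann R (a' * b)"
proof -
  have "h \<in> ann R (c * b) \<longleftrightarrow> h \<in> R \<and> h * b \<in> ann R c" for h c
    using closed \<open>b \<in> R\<close> by (auto simp: ann_def mult.assoc mult.commute[of b c])
  then show ?thesis using assms(3) by blast
qed

lemma ann_mult_cong2:
  assumes closed: "\<forall>x\<in>R. \<forall>y\<in>R. x * y \<in> R"
    and "a' \<in> R" "b \<in> R" and "ann R a = ann R a'" "ann R b = ann R b'"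
  shows "ann R (a * b) = ann R (a' * b')"
  using ann_mult_cong[OF closed \<open>b \<in> R\<close> \<open>ann R a = ann R a'\<close>]
    ann_mult_cong[OF closed \<open>a' \<in> R\<close> \<open>ann R b = ann R b'\<close>]
  by (simp add: mult.commute)

text \<open>
  This rules out an edge between elements with equal annihilators. Replacing \<open>b\<close> by \<open>a\<close> reduces
  the claim to \<open>ann (a * a) = ann a\<close>; there, if \<open>h * (a * a) = 0\<close>, then \<open>h * a\<close> has square zero.
\<close>

lemma ann_mult_of_ann_eq:
  assumes closed: "\<forall>x\<in>R. \<forall>y\<in>R. x * y \<in> R"
    and reduced: "\<forall>x\<in>R. x * x = 0 \<longrightarrow> x = 0"
    and "a \<in> R" and "b \<in> R" and eq: "ann R a = ann R b"
  shows "ann R (a * b) = ann R a"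
proof -
  have "h * a = 0" if "h \<in> R" "h * (a * a) = 0" for h
  proof -
    have "h * a \<in> R" using closed that(1) \<open>a \<in> R\<close> by blast
    have "(h * a) * (h * a) = h * (h * (a * a))" by (simp add: ac_simps)
    with that(2) have "(h * a) * (h * a) = 0" by simp
    with \<open>h * a \<in> R\<close> show ?thesis using reduced by blast
  qed
  then have "ann R (a * a) = ann R a" by (auto simp: ann_def mult.assoc[symmetric])
  moreover have "ann R (a * b) = ann R (a * a)"
    using ann_mult_cong2[OF closed \<open>a \<in> R\<close> \<open>b \<in> R\<close> refl eq[symmetric]] .
  ultimately show ?thesis by simp
qed

lemma annihilator_graph_edge_iff:
  "{a, b} \<in> snd (annihilator_graph R) \<longleftrightarrow>
     a \<in> nz_zero_divisors R \<and> b \<in> nz_zero_divisors R \<and> a \<noteq> b \<and>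
     ann R a \<union> ann R b \<noteq> ann R (a * b)"
proof
  assume "{a, b} \<in> snd (annihilator_graph R)"
  then obtain c d where "{a, b} = {c, d}"
    and cd: "c \<in> nz_zero_divisors R" "d \<in> nz_zero_divisors R" "c \<noteq> d"
      "ann R c \<union> ann R d \<noteq> ann R (c * d)"
    unfolding annihilator_graph_def by auto
  then consider "a = c" "b = d" | "a = d" "b = c" unfolding doubleton_eq_iff by blast
  then show "a \<in> nz_zero_divisors R \<and> b \<in> nz_zero_divisors R \<and> a \<noteq> b \<and>
     ann R a \<union> ann R b \<noteq> ann R (a * b)"
  proof cases
    case 1
    then show ?thesis using cd by simp
  next
    case 2
    then show ?thesis using cd by (simp add: Un_commute[of "ann R d"] mult.commute[of d])
  qed
qed (auto simp: annihilator_graph_def)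

lemma is_clique_induced_subgraph:
  "is_clique (induced_subgraph H W) K \<longleftrightarrow>
     K \<subseteq> W \<and> (\<forall>x\<in>K. \<forall>y\<in>K. x \<noteq> y \<longrightarrow> {x, y} \<in> snd H)"
  by (auto simp: is_clique_def induced_subgraph_def)

lemma clique_number_ann_representatives:
  assumes closed: "\<forall>x\<in>R. \<forall>y\<in>R. x * y \<in> R"
    and reduced: "\<forall>x\<in>R. x * x = 0 \<longrightarrow> x = 0"
    and W: "W \<subseteq> nz_zero_divisors R"
    and rep: "\<And>a. a \<in> nz_zero_divisors R \<Longrightarrow> \<exists>s\<in>W. ann R s = ann R a"
  shows "clique_number (induced_subgraph (annihilator_graph R) W)
           =o clique_number (annihilator_graph R)"
proof -
  let ?H = "annihilator_graph R"
  have inR: "a \<in> R" if "a \<in> nz_zero_divisors R" for a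
    using that by (simp add: nz_zero_divisors_def)
  have "\<forall>a \<in> nz_zero_divisors R. \<exists>s. s \<in> W \<and> ann R s = ann R a" using rep by blast
  from bchoice[OF this] obtain \<rho>
    where \<rho>W: "\<And>a. a \<in> nz_zero_divisors R \<Longrightarrow> \<rho> a \<in> W"
      and \<rho>: "\<And>a. a \<in> nz_zero_divisors R \<Longrightarrow> ann R (\<rho> a) = ann R a"
    by blast
  have edge: "\<rho> a \<noteq> \<rho> b \<and> {\<rho> a, \<rho> b} \<in> snd ?H" if "{a, b} \<in> snd ?H" for a b
  proof -
    from that have a: "a \<in> nz_zero_divisors R" and b: "b \<in> nz_zero_divisors R"
      and ne: "ann R a \<union> ann R b \<noteq> ann R (a * b)"
      by (simp_all add: annihilator_graph_edge_iff)
    have "ann R a \<noteq> ann R b"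
    proof
      assume eq: "ann R a = ann R b"
      show False
        using ann_mult_of_ann_eq[OF closed reduced inR[OF a] inR[OF b] eq] ne eq by simp
    qed
    then have "\<rho> a \<noteq> \<rho> b" using \<rho>[OF a] \<rho>[OF b] by auto
    moreover have "ann R (\<rho> a * \<rho> b) = ann R (a * b)"
    proof (rule ann_mult_cong2[OF closed inR[OF a] _ \<rho>[OF a] \<rho>[OF b]])
      show "\<rho> b \<in> R" using \<rho>W[OF b] W by (blast intro: inR)
    qed
    ultimately show ?thesis
      using ne \<rho>[OF a] \<rho>[OF b] \<rho>W[OF a] \<rho>W[OF b] W
      by (auto simp: annihilator_graph_edge_iff)
  qed
  have "clique_number ?H \<le>o clique_number (induced_subgraph ?H W)"
  proof (rule clique_number_mono)
    fix K assume K: "is_clique ?H K"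
    have KV: "K \<subseteq> nz_zero_divisors R"
      using K by (simp add: is_clique_def annihilator_graph_def)
    have Ke: "{x, y} \<in> snd ?H" if "x \<in> K" "y \<in> K" "x \<noteq> y" for x y
      using K that by (simp add: is_clique_def)
    have "inj_on \<rho> K" using edge Ke by (metis inj_onI)
    then have "|K| \<le>o |\<rho> ` K|"
      by (metis card_of_ordLeq order_refl)
    moreover have "is_clique (induced_subgraph ?H W) (\<rho> ` K)"
    proof -
      have "{x, y} \<in> snd ?H" if "x \<in> \<rho> ` K" "y \<in> \<rho> ` K" "x \<noteq> y" for x y
      proof -
        from that(1,2) obtain a b where "a \<in> K" "b \<in> K" "x = \<rho> a" "y = \<rho> b" by auto
        with that(3) show ?thesis using edge[OF Ke[of a b]] by auto
      qed
      then show ?thesis using KV \<rho>W by (auto simp: is_clique_induced_subgraph)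
    qed
    ultimately show "\<exists>K'. is_clique (induced_subgraph ?H W) K' \<and> |K| \<le>o |K'|" by blast
  qed
  moreover have "clique_number (induced_subgraph ?H W) \<le>o clique_number ?H"
  proof (rule clique_number_mono)
    fix K assume "is_clique (induced_subgraph ?H W) K"
    then have KW: "K \<subseteq> W" and Ke: "\<forall>x\<in>K. \<forall>y\<in>K. x \<noteq> y \<longrightarrow> {x, y} \<in> snd ?H"
      by (simp_all add: is_clique_induced_subgraph)
    have "K \<subseteq> fst ?H" using KW W by (auto simp: annihilator_graph_def)
    with Ke have "is_clique ?H K" by (simp add: is_clique_def)
    then show "\<exists>K'. is_clique ?H K' \<and> |K| \<le>o |K'|" using card_of_refl ordIso_imp_ordLeq by blast
  qed
  ultimately show ?thesis by (simp add: ordIso_iff_ordLeq)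
qed

section \<open>Cozero sets and annihilators of continuous functions\<close>

lemma CP_ring_outside: "f \<in> CP_ring X \<P> \<Longrightarrow> x \<notin> topspace X \<Longrightarrow> f x = 0"
  by (simp add: CP_ring_def C_ring_def)

lemma real_fun_square_eq_0:
  assumes "f * f = (0 :: 'a \<Rightarrow> real)" shows "f = 0"
  using assms by (auto simp: fun_eq_iff times_fun_def zero_fun_def)

lemma openin_cozero:
  assumes "f \<in> CP_ring X \<P>" shows "openin X (topspace X - zero_set X f)"
proof -
  have "continuous_map X euclideanreal f"
    using assms by (simp add: CP_ring_def C_ring_def)
  then have "openin X {x \<in> topspace X. f x \<in> - {0}}"
    by (rule openin_continuous_map_preimage) auto
  moreover have "{x \<in> topspace X. f x \<in> - {0}} = topspace X - zero_set X f"
    by (auto simp: zero_set_def)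
  ultimately show ?thesis by simp
qed

lemma cozero_subset_X_sub:
  assumes "f \<in> CP_ring X \<P>" shows "topspace X - zero_set X f \<subseteq> X_sub X \<P>"
  using openin_cozero[OF assms] assms by (auto simp: X_sub_def CP_ring_def)

text \<open>
  A product vanishes iff the cozero set of \<open>h\<close> lies in the zero set of \<open>f\<close>; being open and
  contained in \<open>X_sub X \<P>\<close>, it then lies in the smaller set by which
  \<open>int_zero_rel\<close> compares functions.
\<close>

lemma mult_eq_0_iff_cozero_subset:
  assumes h: "h \<in> CP_ring X \<P>"
  shows "h * f = 0 \<longleftrightarrow>
    topspace X - zero_set X h \<subseteq> X interior_of zero_set X f \<inter> X_sub X \<P>"
proof -
  have "h * f = 0 \<longleftrightarrow> topspace X - zero_set X h \<subseteq> zero_set X f"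
    using CP_ring_outside[OF h]
    by (auto simp: fun_eq_iff times_fun_def zero_fun_def zero_set_def)
  also have "\<dots> \<longleftrightarrow> topspace X - zero_set X h \<subseteq> X interior_of zero_set X f"
    by (meson interior_of_maximal interior_of_subset openin_cozero[OF h] subset_trans)
  finally show ?thesis using cozero_subset_X_sub[OF h] by blast
qed

lemma ann_eq_of_int_zero_rel:
  assumes "(f, g) \<in> int_zero_rel X \<P>"
  shows "ann (CP_ring X \<P>) f = ann (CP_ring X \<P>) g"
proof -
  have "X interior_of zero_set X f \<inter> X_sub X \<P> = X interior_of zero_set X g \<inter> X_sub X \<P>"
    using assms by (simp add: int_zero_rel_def)
  then have "h * f = 0 \<longleftrightarrow> h * g = 0" if "h \<in> CP_ring X \<P>" for h
    unfolding mult_eq_0_iff_cozero_subset[OF that] by (simp only:)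
  then show ?thesis by (auto simp: ann_def)
qed

text \<open>
  A point of \<open>X_sub X \<P>\<close> has a neighbourhood \<open>W\<close> whose closure belongs to \<open>\<P>\<close>.
  A function separating the point from the complement of \<open>U \<inter> W\<close>, rather than of \<open>U\<close>, has
  its support inside that closure, and this puts it into the ring.
\<close>

lemma CP_ring_bump:
  assumes reg: "completely_regular_space X" and P: "ideal_of_closed_sets X \<P>"
    and U: "openin X U" and x: "x \<in> U \<inter> X_sub X \<P>"
  shows "\<exists>b \<in> CP_ring X \<P>. b x \<noteq> 0 \<and> topspace X - zero_set X b \<subseteq> U"
proof -
  from x obtain W where W: "openin X W" "x \<in> W" "X closure_of W \<in> \<P>"
    by (auto simp: X_sub_def)
  have "closedin X (topspace X - U \<inter> W)" using U W(1) by auto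
  moreover have "x \<in> topspace X - (topspace X - U \<inter> W)"
    using x W openin_subset[OF U] by auto
  ultimately obtain g where g: "continuous_map X euclideanreal g" "g x = 0"
      "g ` (topspace X - U \<inter> W) \<subseteq> {1}"
    using reg unfolding completely_regular_space_alt by meson
  define b where "b = (\<lambda>y. if y \<in> topspace X then 1 - g y else 0)"
  have coz: "topspace X - zero_set X b \<subseteq> U \<inter> W"
    using g(3) by (auto simp: b_def zero_set_def)
  have "continuous_map X euclideanreal b"
  proof (rule continuous_map_eq)
    show "continuous_map X euclideanreal (\<lambda>y. 1 - g y)"
      using g(1) by (intro continuous_map_diff) auto
  qed (simp add: b_def)
  then have "b \<in> C_ring X" by (simp add: C_ring_def b_def)
  moreover have "X closure_of (topspace X - zero_set X b) \<in> \<P>"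
  proof -
    have "X closure_of (topspace X - zero_set X b) \<subseteq> X closure_of W"
      using coz by (intro closure_of_mono) auto
    then show ?thesis using P W(3) unfolding ideal_of_closed_sets_def by (meson closedin_closure_of)
  qed
  ultimately have "b \<in> CP_ring X \<P>" by (simp add: CP_ring_def)
  moreover have "b x \<noteq> 0" using x g(2) by (auto simp: b_def X_sub_def)
  ultimately show ?thesis using coz by blast
qed

section \<open>Representatives of the zero divisors\<close>

lemma V_set_subset_nz_zero_divisors:
  assumes "completely_regular_space X" and "ideal_of_closed_sets X \<P>" and S: "S \<subseteq> CP_ring X \<P>"
  shows "V_set X \<P> S \<subseteq> nz_zero_divisors (CP_ring X \<P>)"
proof
  fix f assume f: "f \<in> V_set X \<P> S"
  let ?U = "X interior_of zero_set X f"
  from f obtain x where x: "x \<in> ?U \<inter> X_sub X \<P>"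
    by (auto simp: V_set_def)
  obtain b where b: "b \<in> CP_ring X \<P>" "b x \<noteq> 0" "topspace X - zero_set X b \<subseteq> ?U"
    using CP_ring_bump[OF assms(1,2) openin_interior_of x] by blast
  have "b * f = 0"
    using mult_eq_0_iff_cozero_subset[OF b(1)] b(3) cozero_subset_X_sub[OF b(1)] by simp
  then have "f * b = 0" by (simp only: mult.commute)
  moreover have "b \<noteq> 0" using b(2) by (auto simp: zero_fun_def)
  moreover have "f \<in> CP_ring X \<P>" "f \<noteq> 0" using f S by (auto simp: V_set_def)
  ultimately show "f \<in> nz_zero_divisors (CP_ring X \<P>)"
    using b(1) by (auto simp: nz_zero_divisors_def)
qed

lemma nz_zero_divisor_representative_in_V_set:
  assumes S: "is_transversal (CP_ring X \<P>) (int_zero_rel X \<P>) S"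
    and a: "a \<in> nz_zero_divisors (CP_ring X \<P>)"
  shows "\<exists>s \<in> V_set X \<P> S. ann (CP_ring X \<P>) s = ann (CP_ring X \<P>) a"
proof -
  let ?R = "CP_ring X \<P>" and ?r = "int_zero_rel X \<P>"
  from a obtain b where aR: "a \<in> ?R" and a0: "a \<noteq> 0"
    and b: "b \<in> ?R" "b \<noteq> 0" "a * b = 0"
    by (auto simp: nz_zero_divisors_def)
  have "?r `` {a} \<in> ?R // ?r" using aR by (rule quotientI)
  with S have "\<exists>!s. s \<in> S \<inter> ?r `` {a}" unfolding is_transversal_def by (elim conjE) (rule bspec)
  then obtain s where s: "s \<in> S" and as: "(a, s) \<in> ?r" by auto
  have ann_eq: "ann ?R s = ann ?R a" using ann_eq_of_int_zero_rel[OF as] by simp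
  have "s \<noteq> 0"
  proof
    \<comment> \<open>Everything annihilates 0, so \<open>a\<close> would annihilate itself.\<close>
    assume "s = 0"
    then have "a \<in> ann ?R a" using ann_eq aR by (auto simp: ann_def)
    then show False using real_fun_square_eq_0[of a] a0 by (simp add: ann_def)
  qed
  moreover have "X interior_of zero_set X s \<inter> X_sub X \<P> \<noteq> {}"
  proof -
    have "b \<in> ann ?R a" using b(1,3) by (simp add: ann_def mult.commute[of b])
    then have "b \<in> ann ?R s" by (simp only: ann_eq)
    then have "b * s = 0" by (simp add: ann_def)
    then have "topspace X - zero_set X b \<subseteq> X interior_of zero_set X s \<inter> X_sub X \<P>"
      by (rule mult_eq_0_iff_cozero_subset[OF b(1), THEN iffD1])
    moreover have "topspace X - zero_set X b \<noteq> {}"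
    proof -
      obtain x where "b x \<noteq> 0" using b(2) by (auto simp: fun_eq_iff)
      moreover from this have "x \<in> topspace X" using CP_ring_outside[OF b(1)] by blast
      ultimately show ?thesis by (auto simp: zero_set_def)
    qed
    ultimately show ?thesis by blast
  qed
  ultimately have "s \<in> V_set X \<P> S" using s by (simp add: V_set_def)
  then show ?thesis using ann_eq by blast
qed

theorem theorem4p27:
  fixes X :: "'a topology" and \<P> :: "'a set set" and S :: "('a \<Rightarrow> real) set"
  assumes "completely_regular_space X" and "Hausdorff_space X"
    and "ideal_of_closed_sets X \<P>"
    and "infinite (X_sub X \<P>) \<or> 3 \<le> card (X_sub X \<P>)"
    and "is_transversal (CP_ring X \<P>) (int_zero_rel X \<P>) S"
  shows "clique_number (G_graph X \<P> S) =o clique_number (annihilator_graph (CP_ring X \<P>))"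
  unfolding G_graph_def
proof (rule clique_number_ann_representatives)
  show "\<forall>f\<in>CP_ring X \<P>. \<forall>g\<in>CP_ring X \<P>. f * g \<in> CP_ring X \<P>"
    by (intro ballI CP_ring_closed(2)[OF assms(3)])
  show "\<forall>f\<in>CP_ring X \<P>. f * f = 0 \<longrightarrow> f = 0"
    by (intro ballI impI) (rule real_fun_square_eq_0)
  show "V_set X \<P> S \<subseteq> nz_zero_divisors (CP_ring X \<P>)"
    using assms(5) by (intro V_set_subset_nz_zero_divisors[OF assms(1,3)]) (simp add: is_transversal_def)
  show "\<exists>s \<in> V_set X \<P> S. ann (CP_ring X \<P>) s = ann (CP_ring X \<P>) a"
    if "a \<in> nz_zero_divisors (CP_ring X \<P>)" for a
    using nz_zero_divisor_representative_in_V_set[OF assms(5) that] .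
qed

end
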